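(* Let $\alpha\in(1,2)$ and $1/\alpha<H<1$. Let $\{X_{H,\alpha}(t)\}_{t\in\mathbb{R}}$ be the symmetric $\alpha$-stable linear fractional stable motion, let $\psi$ be a real-valued continuous function, not identically zero, supported in $[0,1]$, with $\int_{\mathbb{R}}\psi(s)\,ds=\int_{\mathbb{R}}s\psi(s)\,ds=0$, and let $d_{j,k}=2^j\int_{\mathbb{R}}X_{H,\alpha}(t)\psi(2^jt-k)\,dt$ and $D_j=\max_{0\le k<2^j}|d_{j,k}|$. Then, almost surely, for all arbitrarily small $\epsilon>0$, $$\limsup_{j\to+\infty}\left\{2^{j(H-1/\alpha-\epsilon)}D_j\right\}<\infty.$$
   Context: The linear fractional stable motion is defined for $t\in\mathbb{R}$ by $$X_{H,\alpha}(t)=\int_{\mathbb{R}}\Big\{(t-s)_+^{H-1/\alpha}-(-s)_+^{H-1/\alpha}\Big\}\,Z_\alpha(ds),$$ where $(z)_+=\max\{z,0\}$ and $Z_\alpha$ is a symmetric $\alpha$-stable random measure on $\mathbb{R}$ with Lebesgue control measure (so for $f\in L^\alpha(\mathbb{R})$, $\mathbb{E}\exp(i\theta\int f\,dZ_\alpha)=\exp(-|\theta|^\alpha\int|f(s)|^\alpha ds)$ for all $\theta\in\mathbb{R}$). Since $H>1/\alpha$, this process has a modification with continuous sample paths, and $X_{H,\alpha}$ is identified with this modification, so that the integrals defining $d_{j,k}$ are pathwise integrals. "Almost surely, for all $\epsilon$" means that there is one event of probability $1$ on which the relation holds for all such $\epsilon$. *)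

theory Defs
  imports "HOL-Probability.Probability"
begin

text \<open>
  A symmetric \<open>\<alpha>\<close>-stable random measure on the real line with Lebesgue control measure.
  The values \<open>Z A\<close> are only constrained for Borel sets \<open>A\<close> of finite Lebesgue measure.
\<close>

locale SaS_random_measure = prob_space M
  for M :: "'a measure" and \<alpha> :: real and Z :: "real set \<Rightarrow> 'a \<Rightarrow> real" +
  assumes random_variable_Z:
      "\<And>A. A \<in> sets borel \<Longrightarrow> emeasure lborel A < \<infinity> \<Longrightarrow> random_variable borel (Z A)"
    and char_Z:
      "\<And>A \<theta>. A \<in> sets borel \<Longrightarrow> emeasure lborel A < \<infinity> \<Longrightarrow>
        char (distr M borel (Z A)) \<theta> = complex_of_real (exp (- (\<bar>\<theta>\<bar> powr \<alpha> * measure lborel A)))"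
    and independently_scattered:
      "\<And>C n. (\<And>i. i < n \<Longrightarrow> C i \<in> sets borel \<and> emeasure lborel (C i) < \<infinity>) \<Longrightarrow>
        disjoint_family_on C {..<n::nat} \<Longrightarrow>
        indep_vars (\<lambda>_. borel) (\<lambda>i. Z (C i)) {..<n}"
    and sigma_additive:
      "\<And>B. (\<And>i::nat. B i \<in> sets borel) \<Longrightarrow> disjoint_family B \<Longrightarrow>
        emeasure lborel (\<Union>i. B i) < \<infinity> \<Longrightarrow>
        AE \<omega> in M. (\<lambda>i. Z (B i) \<omega>) sums Z (\<Union>i. B i) \<omega>"

definition tendsto_in_probability ::
    "'a measure \<Rightarrow> (nat \<Rightarrow> 'a \<Rightarrow> real) \<Rightarrow> ('a \<Rightarrow> real) \<Rightarrow> bool" where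
  "tendsto_in_probability M Y Y' \<longleftrightarrow>
    (\<forall>e>0. (\<lambda>n. measure M {\<omega> \<in> space M. \<bar>Y n \<omega> - Y' \<omega>\<bar> > e}) \<longlonglongrightarrow> 0)"

text \<open>
  Used only for simple Borel functions \<open>f\<close> that vanish outside a set of finite Lebesgue measure. The level set of the value 0
  may have infinite measure, but its summand is 0.
\<close>

definition simple_stable_integral ::
    "(real set \<Rightarrow> 'a \<Rightarrow> real) \<Rightarrow> (real \<Rightarrow> real) \<Rightarrow> 'a \<Rightarrow> real" where
  "simple_stable_integral Z f \<omega> = (\<Sum>y\<in>range f. y * Z (f -` {y}) \<omega>)"

text \<open>
  The random variable \<open>Y\<close> is a version of the integral of \<open>f \<in> L\<^sup>\<alpha>\<close> with respect to \<open>Z\<close>: the limit in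
  probability of the integrals of simple functions that converge to \<open>f\<close> in \<open>L\<^sup>\<alpha>\<close>. It is
  determined up to almost sure equality.
\<close>

definition has_stable_integral ::
    "'a measure \<Rightarrow> real \<Rightarrow> (real set \<Rightarrow> 'a \<Rightarrow> real) \<Rightarrow> (real \<Rightarrow> real) \<Rightarrow> ('a \<Rightarrow> real) \<Rightarrow> bool" where
  "has_stable_integral M \<alpha> Z f Y \<longleftrightarrow>
    f \<in> borel_measurable borel \<and> integrable lborel (\<lambda>s. \<bar>f s\<bar> powr \<alpha>) \<and>
    Y \<in> borel_measurable M \<and>
    (\<exists>g. (\<forall>n. simple_function lborel (g n) \<and> emeasure lborel {s. g n s \<noteq> 0} < \<infinity>) \<and>
         (\<lambda>n. \<integral>s. \<bar>f s - g n s\<bar> powr \<alpha> \<partial>lborel) \<longlonglongrightarrow> 0 \<and>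
         tendsto_in_probability M (\<lambda>n. simple_stable_integral Z (g n)) Y)"

definition lfsm_kernel :: "real \<Rightarrow> real \<Rightarrow> real \<Rightarrow> real \<Rightarrow> real" where
  "lfsm_kernel H \<alpha> t s = max 0 (t - s) powr (H - 1/\<alpha>) - max 0 (- s) powr (H - 1/\<alpha>)"

text \<open>
  The linear fractional stable motion driven by \<open>Z\<close>, identified with its modification with
  continuous sample paths.
\<close>

definition is_lfsm ::
    "'a measure \<Rightarrow> real \<Rightarrow> real \<Rightarrow> (real set \<Rightarrow> 'a \<Rightarrow> real) \<Rightarrow> (real \<Rightarrow> 'a \<Rightarrow> real) \<Rightarrow> bool" where
  "is_lfsm M H \<alpha> Z X \<longleftrightarrow>
    (\<forall>t. has_stable_integral M \<alpha> Z (lfsm_kernel H \<alpha> t) (X t)) \<and>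
    (\<forall>\<omega>\<in>space M. continuous_on UNIV (\<lambda>t. X t \<omega>))"

definition wavelet_coeff ::
    "(real \<Rightarrow> 'a \<Rightarrow> real) \<Rightarrow> (real \<Rightarrow> real) \<Rightarrow> nat \<Rightarrow> nat \<Rightarrow> 'a \<Rightarrow> real" where
  "wavelet_coeff X \<psi> j k \<omega> = 2 ^ j * (\<integral>t. X t \<omega> * \<psi> (2 ^ j * t - real k) \<partial>lborel)"

definition wavelet_max ::
    "(real \<Rightarrow> 'a \<Rightarrow> real) \<Rightarrow> (real \<Rightarrow> real) \<Rightarrow> nat \<Rightarrow> 'a \<Rightarrow> real" where
  "wavelet_max X \<psi> j \<omega> = Max ((\<lambda>k. \<bar>wavelet_coeff X \<psi> j k \<omega>\<bar>) ` {0..<2 ^ j})"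

end

theory Submission
  imports Defs
begin

text \<open>
  Since \<open>\<psi>\<close> has integral \<open>0\<close> and is bounded by some \<open>B\<close>,
  \<open>\<bar>d\<^sub>j\<^sub>,\<^sub>k\<bar>\<close> is at most \<open>B\<close> times the average over \<open>u \<in> [0,1]\<close> of the increments
  \<open>\<bar>X ((k + u) / 2^j) - X (k / 2^j)\<bar>\<close>. The tail of each increment at \<open>x\<close> is
  \<open>O(2^(-j \<alpha> H) x^(-\<alpha>))\<close>, because its scale is the \<open>L\<^sup>\<alpha>\<close>-norm of a self-similar kernel, and for
  \<open>\<alpha> > 1\<close> such a weak \<open>L\<^sup>\<alpha>\<close> bound passes to averages. A union bound over \<open>k < 2^j\<close> at the level
  \<open>2^(-j (H - 1/\<alpha> - \<epsilon>))\<close> gives probabilities \<open>O(2^(-j \<alpha> \<epsilon>))\<close>, and Borel--Cantelli concludes.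
  Only tail bounds are carried through the limit in probability that defines the stable integral,
  so neither the law of the limit nor a stochastic Fubini theorem enters.
\<close>

section \<open>Tails from characteristic functions\<close>

text \<open>The average of \<open>1 - cos (\<theta> y)\<close> over \<open>\<theta> \<in> [0, 2/x]\<close> is at least \<open>1/2\<close> whenever \<open>\<bar>y\<bar> \<ge> x\<close>.\<close>

lemma (in prob_space) tail_bound_from_char:
  fixes Y :: "'a \<Rightarrow> real"
  assumes [measurable]: "random_variable borel Y"
    and char: "\<And>\<theta>. 1 - Re (char (distr M borel Y) \<theta>) \<le> c * \<bar>\<theta>\<bar> powr \<alpha>"
    and "0 \<le> c" "0 < \<alpha>" "0 < x"
  shows "prob {\<omega> \<in> space M. x \<le> \<bar>Y \<omega>\<bar>} \<le> 2 powr (1 + \<alpha>) * c * x powr - \<alpha>"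
proof -
  \<comment> \<open>With this \<open>u\<close> the oscillating part \<open>sin (u * y) / y\<close>
    of the primitive is at most \<open>1 / x = u / 2\<close> in absolute value whenever
    \<open>x \<le> \<bar>y\<bar>\<close>, so at least \<open>u / 2\<close> of the length
    \<open>u\<close> survives.\<close>
  define u where "u = 2 / x"
  have "u > 0" using \<open>0 < x\<close> by (simp add: u_def)
  let ?A = "{\<omega> \<in> space M. x \<le> \<bar>Y \<omega>\<bar>}"
  interpret pair_sigma_finite lborel M ..
  have avg: "(\<integral>\<^sup>+\<theta>. ennreal (1 - cos (\<theta> * y)) * indicator {0..u} \<theta> \<partial>lborel) \<ge> ennreal (u / 2)"
    if "x \<le> \<bar>y\<bar>" for y
  proof -
    have "y \<noteq> 0" using that \<open>0 < x\<close> by auto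
    have "(\<integral>\<^sup>+\<theta>. ennreal (1 - cos (\<theta> * y)) * indicator {0..u} \<theta> \<partial>lborel)
        = ennreal ((u - sin (u * y) / y) - (0 - sin (0 * y) / y))"
      using \<open>u > 0\<close> \<open>y \<noteq> 0\<close>
      by (intro nn_integral_FTC_Icc) (auto intro!: derivative_eq_intros)
    moreover have "\<bar>sin (u * y) / y\<bar> \<le> 1 / x"
      unfolding abs_divide using that \<open>0 < x\<close> abs_sin_le_one by (intro frac_le) auto
    then have "u / 2 \<le> (u - sin (u * y) / y) - (0 - sin (0 * y) / y)"
      unfolding abs_le_iff by (simp add: u_def)
    ultimately show ?thesis by (simp only: ennreal_leI)
  qed
  have cosint: "(\<integral>\<^sup>+\<omega>. ennreal (1 - cos (\<theta> * Y \<omega>)) \<partial>M) \<le> ennreal (c * \<bar>\<theta>\<bar> powr \<alpha>)" for \<theta>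
  proof -
    have i: "integrable M (\<lambda>\<omega>. iexp (\<theta> * Y \<omega>))"
      by (rule integrable_iexp) auto
    have "Re (char (distr M borel Y) \<theta>) = (\<integral>\<omega>. Re (iexp (\<theta> * Y \<omega>)) \<partial>M)"
      using i by (simp add: char_def integral_distr)
    also have "\<dots> = expectation (\<lambda>\<omega>. cos (\<theta> * Y \<omega>))"
      by (simp add: Re_exp)
    finally have E: "Re (char (distr M borel Y) \<theta>) = expectation (\<lambda>\<omega>. cos (\<theta> * Y \<omega>))" .
    have ic: "integrable M (\<lambda>\<omega>. cos (\<theta> * Y \<omega>))"
      by (rule integrable_const_bound[where B=1]) auto
    have "(\<integral>\<^sup>+\<omega>. ennreal (1 - cos (\<theta> * Y \<omega>)) \<partial>M) = ennreal (expectation (\<lambda>\<omega>. 1 - cos (\<theta> * Y \<omega>)))"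
      using ic by (intro nn_integral_eq_integral) auto
    also have "expectation (\<lambda>\<omega>. 1 - cos (\<theta> * Y \<omega>)) = 1 - Re (char (distr M borel Y) \<theta>)"
      using ic by (simp add: E prob_space)
    finally show ?thesis using char by (simp add: ennreal_leI)
  qed
  \<comment> \<open>On \<open>?A\<close> the inner integral is at least \<open>u / 2\<close>.
    Tonelli exchanges the integrals, and \<open>cosint\<close> then bounds the expectation for each
    fixed \<open>\<theta>\<close>.\<close>
  have "ennreal (u / 2 * prob ?A) = (\<integral>\<^sup>+\<omega>. ennreal (u / 2) * indicator ?A \<omega> \<partial>M)"
    using \<open>u > 0\<close> by (simp add: nn_integral_cmult_indicator emeasure_eq_measure ennreal_mult[symmetric])
  also have "\<dots> \<le> (\<integral>\<^sup>+\<omega>. \<integral>\<^sup>+\<theta>. ennreal (1 - cos (\<theta> * Y \<omega>)) * indicator {0..u} \<theta> \<partial>lborel \<partial>M)"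
    using avg by (intro nn_integral_mono) (auto split: split_indicator)
  also have "\<dots> = (\<integral>\<^sup>+\<theta>. \<integral>\<^sup>+\<omega>. ennreal (1 - cos (\<theta> * Y \<omega>)) * indicator {0..u} \<theta> \<partial>M \<partial>lborel)"
    by (rule Fubini') measurable
  also have "\<dots> \<le> (\<integral>\<^sup>+\<theta>. ennreal (c * u powr \<alpha>) * indicator {0..u} \<theta> \<partial>lborel)"
  proof (intro nn_integral_mono)
    fix \<theta> :: real
    have "(\<integral>\<^sup>+\<omega>. ennreal (1 - cos (\<theta> * Y \<omega>)) * indicator {0..u} \<theta> \<partial>M) 
       = (\<integral>\<^sup>+\<omega>. ennreal (1 - cos (\<theta> * Y \<omega>)) \<partial>M) * indicator {0..u} \<theta>"
      by (rule nn_integral_multc) measurable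
    also have "\<dots> \<le> ennreal (c * \<bar>\<theta>\<bar> powr \<alpha>) * indicator {0..u} \<theta>"
      by (intro mult_right_mono cosint) simp
    also have "\<dots> \<le> ennreal (c * u powr \<alpha>) * indicator {0..u} \<theta>"
      using assms by (auto split: split_indicator intro!: ennreal_leI mult_left_mono powr_mono2)
    finally show "(\<integral>\<^sup>+\<omega>. ennreal (1 - cos (\<theta> * Y \<omega>)) * indicator {0..u} \<theta> \<partial>M) 
      \<le> ennreal (c * u powr \<alpha>) * indicator {0..u} \<theta>" .
  qed
  also have "\<dots> = ennreal (c * u powr \<alpha> * u)"
    using \<open>u > 0\<close> \<open>0 \<le> c\<close> by (simp add: nn_integral_cmult_indicator ennreal_mult)
  finally have "u / 2 * prob ?A \<le> c * u powr \<alpha> * u"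
    using \<open>u > 0\<close> \<open>0 \<le> c\<close> by (subst (asm) ennreal_le_iff) auto
  then have "prob ?A \<le> 2 * c * u powr \<alpha>"
    using \<open>u > 0\<close> by (simp add: field_simps)
  also have "\<dots> = 2 powr (1 + \<alpha>) * c * x powr - \<alpha>"
    using \<open>0 < x\<close> by (simp add: u_def powr_divide powr_add powr_minus field_simps)
  finally show ?thesis .
qed

section \<open>Stable integrals of simple functions\<close>

context SaS_random_measure
begin

text \<open>Finite additivity comes from \<open>sigma_additive\<close> by padding the family with
  empty sets, once \<open>Z {}\<close> is known to vanish almost surely.\<close>

lemma Z_sum_disjoint:
  assumes "finite I" "disjoint_family_on A I"
    and A: "\<And>i. i \<in> I \<Longrightarrow> A i \<in> sets borel \<and> emeasure lborel (A i) < \<infinity>"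
  shows "AE \<omega> in M. Z (\<Union>i\<in>I. A i) \<omega> = (\<Sum>i\<in>I. Z (A i) \<omega>)"
proof -
  \<comment> \<open>A convergent series all of whose terms equal \<open>Z {} \<omega>\<close> forces
    this value to be 0.\<close>
  have "AE \<omega> in M. (\<lambda>i. Z {} \<omega>) sums Z (\<Union>i::nat. {}) \<omega>"
    by (rule sigma_additive) (auto simp: disjoint_family_on_def)
  then have Z0: "AE \<omega> in M. Z {} \<omega> = 0"
  proof eventually_elim
    case (elim \<omega>)
    then have "(\<lambda>i::nat. Z {} \<omega>) \<longlonglongrightarrow> 0" by (intro summable_LIMSEQ_zero) (auto simp: sums_iff)
    then show ?case by (simp add: LIMSEQ_const_iff)
  qed
  obtain f where f: "bij_betw f {..<card I} I"
    using ex_bij_betw_nat_finite[OF \<open>finite I\<close>] by (auto simp: atLeast0LessThan)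
  define B where "B = (\<lambda>i. if i < card I then A (f i) else {})"
  have fI: "f i \<in> I" if "i < card I" for i
    using f that by (auto dest: bij_betwE)
  have UB: "(\<Union>i. B i) = (\<Union>i\<in>I. A i)"
  proof -
    have "(\<Union>i. B i) = (\<Union>i\<in>{..<card I}. A (f i))"
      by (auto simp: B_def split: if_splits)
    also have "\<dots> = (\<Union>i\<in>f ` {..<card I}. A i)" by auto
    finally show ?thesis using bij_betw_imp_surj_on[OF f] by simp
  qed
  have "AE \<omega> in M. (\<lambda>i. Z (B i) \<omega>) sums Z (\<Union>i. B i) \<omega>"
  proof (rule sigma_additive)
    show "B i \<in> sets borel" for i using A fI by (auto simp: B_def)
    show "disjoint_family B"
      using \<open>disjoint_family_on A I\<close> fI f
      by (auto simp: B_def disjoint_family_on_def bij_betw_def inj_on_def split: if_splits) blast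
    have "emeasure lborel (\<Union>i\<in>I. A i) \<le> (\<Sum>i\<in>I. emeasure lborel (A i))"
      using A by (intro emeasure_subadditive_finite \<open>finite I\<close>) auto
    also have "\<dots> < \<infinity>" using A by (simp add: \<open>finite I\<close>)
    finally show "emeasure lborel (\<Union>i. B i) < \<infinity>" by (simp add: UB)
  qed
  then show ?thesis using Z0
  proof eventually_elim
    case (elim \<omega>)
    have "(\<lambda>i. Z (B i) \<omega>) sums (\<Sum>i<card I. Z (B i) \<omega>)"
      using elim(2) by (intro sums_finite) (auto simp: B_def)
    with elim(1) have "Z (\<Union>i. B i) \<omega> = (\<Sum>i<card I. Z (B i) \<omega>)" by (rule sums_unique2)
    also have "\<dots> = (\<Sum>i<card I. Z (A (f i)) \<omega>)" by (simp add: B_def)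
    also have "\<dots> = (\<Sum>i\<in>I. Z (A i) \<omega>)" by (rule sum.reindex_bij_betw[OF f])
    finally show ?case by (simp add: UB)
  qed
qed

text \<open>Independence on disjoint sets makes the characteristic function a product, and the
  exponents add up. The enumeration \<open>f\<close> is there because
  \<open>independently_scattered\<close> speaks of index sets \<open>{..<n}\<close>.\<close>

lemma char_sum_disjoint:
  assumes "finite I" "disjoint_family_on A I"
    and A: "\<And>i. i \<in> I \<Longrightarrow> A i \<in> sets borel \<and> emeasure lborel (A i) < \<infinity>"
  shows "char (distr M borel (\<lambda>\<omega>. \<Sum>i\<in>I. a i * Z (A i) \<omega>)) \<theta> =
    complex_of_real (exp (- (\<bar>\<theta>\<bar> powr \<alpha> * (\<Sum>i\<in>I. \<bar>a i\<bar> powr \<alpha> * measure lborel (A i)))))"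
proof -
  obtain f where f: "bij_betw f {..<card I} I"
    using ex_bij_betw_nat_finite[OF \<open>finite I\<close>] by (auto simp: atLeast0LessThan)
  have fI: "f i \<in> I" if "i < card I" for i
    using f that by (auto dest: bij_betwE)
  have "indep_vars (\<lambda>_. borel) (\<lambda>i. Z (A (f i))) {..<card I}"
  proof (rule independently_scattered)
    show "disjoint_family_on (\<lambda>i. A (f i)) {..<card I}"
      using \<open>disjoint_family_on A I\<close> fI f
      by (auto simp: disjoint_family_on_def bij_betw_def inj_on_def) blast
  qed (use A fI in auto)
  then have ind: "indep_vars (\<lambda>_. borel) (\<lambda>i \<omega>. a (f i) * Z (A (f i)) \<omega>) {..<card I}"
    by (rule indep_vars_compose2) auto
  \<comment> \<open>The factor \<open>b\<close> moves from the variable into the argument of the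
    characteristic function.\<close>
  have one: "char (distr M borel (\<lambda>\<omega>. b * Z B \<omega>)) \<theta> =
      complex_of_real (exp (- (\<bar>\<theta>\<bar> powr \<alpha> * (\<bar>b\<bar> powr \<alpha> * measure lborel B))))"
    if "B \<in> sets borel" "emeasure lborel B < \<infinity>" for b B
  proof -
    have [measurable]: "Z B \<in> borel_measurable M" using that by (rule random_variable_Z)
    have "char (distr M borel (\<lambda>\<omega>. b * Z B \<omega>)) \<theta> = char (distr M borel (Z B)) (\<theta> * b)"
      by (simp add: char_def integral_distr mult.assoc)
    then show ?thesis by (simp only: char_Z[OF that] abs_mult powr_mult abs_ge_zero mult.assoc)
  qed
  have "char (distr M borel (\<lambda>\<omega>. \<Sum>i\<in>I. a i * Z (A i) \<omega>)) \<theta>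
    = char (distr M borel (\<lambda>\<omega>. \<Sum>i<card I. a (f i) * Z (A (f i)) \<omega>)) \<theta>"
    by (simp add: sum.reindex_bij_betw[OF f, of "\<lambda>i. a i * Z (A i) _", symmetric])
  also have "\<dots> = (\<Prod>i<card I. char (distr M borel (\<lambda>\<omega>. a (f i) * Z (A (f i)) \<omega>)) \<theta>)"
    by (rule char_distr_sum[OF ind])
  also have "\<dots> = (\<Prod>i\<in>I. char (distr M borel (\<lambda>\<omega>. a i * Z (A i) \<omega>)) \<theta>)"
    by (rule prod.reindex_bij_betw[OF f])
  also have "\<dots> = (\<Prod>i\<in>I. complex_of_real (exp (- (\<bar>\<theta>\<bar> powr \<alpha> * (\<bar>a i\<bar> powr \<alpha> * measure lborel (A i))))))"
    by (intro prod.cong refl one) (use A in auto)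
  also have "\<dots> = complex_of_real (exp (\<Sum>i\<in>I. - (\<bar>\<theta>\<bar> powr \<alpha> * (\<bar>a i\<bar> powr \<alpha> * measure lborel (A i)))))"
    by (simp only: exp_sum[OF \<open>finite I\<close>] of_real_prod)
  finally show ?thesis by (simp add: sum_distrib_left sum_negf)
qed

text \<open>The inequality \<open>1 - exp (- s) \<le> s\<close> brings the characteristic function
  into the form that \<open>tail_bound_from_char\<close> asks for.\<close>

lemma tail_sum_disjoint:
  assumes "finite I" "disjoint_family_on A I" "0 < \<alpha>" "0 < x"
    and A: "\<And>i. i \<in> I \<Longrightarrow> A i \<in> sets borel \<and> emeasure lborel (A i) < \<infinity>"
  shows "prob {\<omega> \<in> space M. x \<le> \<bar>\<Sum>i\<in>I. a i * Z (A i) \<omega>\<bar>}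
    \<le> 2 powr (1 + \<alpha>) * (\<Sum>i\<in>I. \<bar>a i\<bar> powr \<alpha> * measure lborel (A i)) * x powr - \<alpha>"
proof (rule tail_bound_from_char)
  show "(\<lambda>\<omega>. \<Sum>i\<in>I. a i * Z (A i) \<omega>) \<in> borel_measurable M"
    using A by (intro borel_measurable_sum borel_measurable_times random_variable_Z) auto
  fix \<theta>
  let ?s = "\<bar>\<theta>\<bar> powr \<alpha> * (\<Sum>i\<in>I. \<bar>a i\<bar> powr \<alpha> * measure lborel (A i))"
  show "1 - Re (char (distr M borel (\<lambda>\<omega>. \<Sum>i\<in>I. a i * Z (A i) \<omega>)) \<theta>)
    \<le> (\<Sum>i\<in>I. \<bar>a i\<bar> powr \<alpha> * measure lborel (A i)) * \<bar>\<theta>\<bar> powr \<alpha>"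
    using exp_ge_add_one_self[of "- ?s"] by (subst char_sum_disjoint) (use assms in \<open>auto simp: mult.commute\<close>)
qed (use assms in \<open>auto intro!: sum_nonneg\<close>)

lemma borel_measurable_simple_stable_integral:
  assumes g: "simple_function lborel g" "emeasure lborel {s. g s \<noteq> 0} < \<infinity>"
  shows "simple_stable_integral Z g \<in> borel_measurable M"
proof -
  \<comment> \<open>The level set of 0 has infinite measure, so nothing is assumed about
    \<open>Z\<close> on it. Its coefficient 0 removes it from the sum before measurability is
    discussed.\<close>
  have "(\<lambda>\<omega>. \<Sum>y\<in>range g. y * Z (g -` {y}) \<omega>) = (\<lambda>\<omega>. \<Sum>y\<in>range g - {0}. y * Z (g -` {y}) \<omega>)"
    using g(1) by (intro ext sum.mono_neutral_right) (auto simp: simple_function_def)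
  moreover have "Z (g -` {y}) \<in> borel_measurable M" if "y \<noteq> 0" for y
  proof (rule random_variable_Z)
    show "g -` {y} \<in> sets borel" using simple_functionD(2)[OF g(1), of "{y}"] by auto
    have [measurable]: "g \<in> borel_measurable borel"
      using g(1) by (auto dest: borel_measurable_simple_function)
    have "emeasure lborel (g -` {y}) \<le> emeasure lborel {s. g s \<noteq> 0}"
      using that by (intro emeasure_mono) auto
    then show "emeasure lborel (g -` {y}) < \<infinity>" using g(2) by simp
  qed
  ultimately show ?thesis unfolding simple_stable_integral_def[abs_def] by simp
qed

text \<open>On a common partition both integrals are almost surely sums over the same disjoint
  cells, so their difference is again such a sum, with coefficients \<open>fst p - snd p\<close>,
  and \<open>tail_sum_disjoint\<close> applies. The same cells express the integral of
  \<open>\<bar>g s - h s\<bar> powr \<alpha>\<close> as a finite sum.\<close>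

lemma tail_simple_stable_integral_diff:
  assumes "0 < \<alpha>" "0 < x"
    and g: "simple_function lborel g" "emeasure lborel {s. g s \<noteq> 0} < \<infinity>"
    and h: "simple_function lborel h" "emeasure lborel {s. h s \<noteq> 0} < \<infinity>"
  shows "integrable lborel (\<lambda>s. \<bar>g s - h s\<bar> powr \<alpha>)"
    and "prob {\<omega> \<in> space M. x \<le> \<bar>simple_stable_integral Z g \<omega> - simple_stable_integral Z h \<omega>\<bar>}
    \<le> 2 powr (1 + \<alpha>) * (\<integral>s. \<bar>g s - h s\<bar> powr \<alpha> \<partial>lborel) * x powr - \<alpha>" (is ?tail)
proof -
  \<comment> \<open>the common refinement of the level sets; \<open>(0,0)\<close> is left out since \<open>A (0,0)\<close> has infinite measure\<close>
  define A where "A = (\<lambda>(y,z). {s. g s = y \<and> h s = z})"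
  define I where "I = range g \<times> range h - {(0,0)}"
  have fg: "finite (range g)" and fh: "finite (range h)"
    using g(1) h(1) by (auto simp: simple_function_def)
  then have "finite I" by (simp add: I_def)
  have gm: "g -` {y} \<in> sets borel" and hm: "h -` {y} \<in> sets borel" for y
    using simple_functionD(2)[OF g(1), of "{y}"] simple_functionD(2)[OF h(1), of "{y}"] by auto
  have disj: "disjoint_family_on A J" for J by (auto simp: disjoint_family_on_def A_def)
  have Am: "A p \<in> sets borel" for p
  proof -
    have "A p = g -` {fst p} \<inter> h -` {snd p}" by (auto simp: A_def split: prod.splits)
    with gm hm show ?thesis by auto
  qed
  have Af: "emeasure lborel (A p) < \<infinity>" if "p \<noteq> (0,0)" for p
  proof -
    have [measurable]: "g \<in> borel_measurable borel" "h \<in> borel_measurable borel"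
      using g(1) h(1) by (auto dest: borel_measurable_simple_function)
    have "emeasure lborel (A p) \<le> emeasure lborel ({s. g s \<noteq> 0} \<union> {s. h s \<noteq> 0})"
      using that by (intro emeasure_mono) (auto simp: A_def split: prod.splits)
    also have "\<dots> \<le> emeasure lborel {s. g s \<noteq> 0} + emeasure lborel {s. h s \<noteq> 0}"
      by (intro emeasure_subadditive) measurable
    also have "\<dots> < \<infinity>" using g(2) h(2) by (simp add: ennreal_add_eq_top less_top[symmetric])
    finally show ?thesis .
  qed
  \<comment> \<open>Each nonzero level set of \<open>g\<close> is cut along the values of
    \<open>h\<close> into cells of finite measure, where \<open>Z_sum_disjoint\<close> applies. The
    pairs in \<open>I\<close> with first entry 0 may be added afterwards, as their coefficient is
    0.\<close>
  have AeG: "AE \<omega> in M. simple_stable_integral Z g \<omega> = (\<Sum>p\<in>I. fst p * Z (A p) \<omega>)"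
  proof -
    have "AE \<omega> in M. \<forall>y\<in>range g - {0}. Z (\<Union>z\<in>range h. A (y,z)) \<omega> = (\<Sum>z\<in>range h. Z (A (y,z)) \<omega>)"
      using fg fh Am Af by (intro AE_finite_allI Z_sum_disjoint)
         (auto simp: A_def disjoint_family_on_def)
    then show ?thesis
    proof eventually_elim
      case (elim \<omega>)
      have "simple_stable_integral Z g \<omega> = (\<Sum>y\<in>range g - {0}. y * Z (g -` {y}) \<omega>)"
        unfolding simple_stable_integral_def using fg by (intro sum.mono_neutral_right) auto
      also have "\<dots> = (\<Sum>y\<in>range g - {0}. \<Sum>z\<in>range h. y * Z (A (y,z)) \<omega>)"
      proof (intro sum.cong refl)
        fix y assume y: "y \<in> range g - {0}"
        have "g -` {y} = (\<Union>z\<in>range h. A (y,z))" by (auto simp: A_def)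
        then show "y * Z (g -` {y}) \<omega> = (\<Sum>z\<in>range h. y * Z (A (y,z)) \<omega>)"
          using elim y by (simp add: sum_distrib_left)
      qed
      also have "\<dots> = (\<Sum>p\<in>(range g - {0}) \<times> range h. fst p * Z (A p) \<omega>)"
        by (simp add: sum.cartesian_product split_beta)
      also have "\<dots> = (\<Sum>p\<in>I. fst p * Z (A p) \<omega>)"
        using \<open>finite I\<close> by (intro sum.mono_neutral_left) (auto simp: I_def)
      finally show ?case .
    qed
  qed
  have AeH: "AE \<omega> in M. simple_stable_integral Z h \<omega> = (\<Sum>p\<in>I. snd p * Z (A p) \<omega>)"
  proof -
    have "AE \<omega> in M. \<forall>z\<in>range h - {0}. Z (\<Union>y\<in>range g. A (y,z)) \<omega> = (\<Sum>y\<in>range g. Z (A (y,z)) \<omega>)"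
      using fg fh Am Af by (intro AE_finite_allI Z_sum_disjoint)
         (auto simp: A_def disjoint_family_on_def)
    then show ?thesis
    proof eventually_elim
      case (elim \<omega>)
      have "simple_stable_integral Z h \<omega> = (\<Sum>z\<in>range h - {0}. z * Z (h -` {z}) \<omega>)"
        unfolding simple_stable_integral_def using fh by (intro sum.mono_neutral_right) auto
      also have "\<dots> = (\<Sum>z\<in>range h - {0}. \<Sum>y\<in>range g. z * Z (A (y,z)) \<omega>)"
      proof (intro sum.cong refl)
        fix z assume z: "z \<in> range h - {0}"
        have "h -` {z} = (\<Union>y\<in>range g. A (y,z))" by (auto simp: A_def)
        then show "z * Z (h -` {z}) \<omega> = (\<Sum>y\<in>range g. z * Z (A (y,z)) \<omega>)"
          using elim z by (simp add: sum_distrib_left)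
      qed
      also have "\<dots> = (\<Sum>y\<in>range g. \<Sum>z\<in>range h - {0}. z * Z (A (y,z)) \<omega>)"
        by (rule sum.swap)
      also have "\<dots> = (\<Sum>p\<in>range g \<times> (range h - {0}). snd p * Z (A p) \<omega>)"
        by (simp add: sum.cartesian_product split_beta)
      also have "\<dots> = (\<Sum>p\<in>I. snd p * Z (A p) \<omega>)"
        using \<open>finite I\<close> by (intro sum.mono_neutral_left) (auto simp: I_def)
      finally show ?case .
    qed
  qed
  \<comment> \<open>Every \<open>s\<close> lies in exactly one cell. If this is the omitted cell of
    \<open>(0,0)\<close>, both sides are 0.\<close>
  have pw: "\<bar>g s - h s\<bar> powr \<alpha> = (\<Sum>p\<in>I. \<bar>fst p - snd p\<bar> powr \<alpha> * indicator (A p) s)" for s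
  proof (cases "(g s, h s) \<in> I")
    case True
    have "(\<Sum>p\<in>I. \<bar>fst p - snd p\<bar> powr \<alpha> * indicator (A p) s) = 
       (\<Sum>p\<in>{(g s, h s)}. \<bar>fst p - snd p\<bar> powr \<alpha> * indicator (A p) s)"
      using True \<open>finite I\<close> by (intro sum.mono_neutral_right) (auto simp: A_def indicator_def)
    then show ?thesis by (simp add: A_def)
  next
    case False
    have "(\<Sum>p\<in>I. \<bar>fst p - snd p\<bar> powr \<alpha> * indicator (A p) s) = 0"
      using False by (intro sum.neutral) (auto simp: A_def indicator_def)
    moreover have "g s = 0" "h s = 0" using False by (auto simp: I_def)
    ultimately show ?thesis by simp
  qed
  have int: "integrable lborel (\<lambda>s. \<bar>fst p - snd p\<bar> powr \<alpha> * indicator (A p) s)" if "p \<in> I" for p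
    using that Am Af by (intro integrable_mult_right integrable_real_indicator) (auto simp: I_def)
  show "integrable lborel (\<lambda>s. \<bar>g s - h s\<bar> powr \<alpha>)"
    unfolding pw by (intro Bochner_Integration.integrable_sum int)
  have eq: "(\<integral>s. \<bar>g s - h s\<bar> powr \<alpha> \<partial>lborel) = (\<Sum>p\<in>I. \<bar>fst p - snd p\<bar> powr \<alpha> * measure lborel (A p))"
    unfolding pw by (subst Bochner_Integration.integral_sum) (use int in auto)
  have [measurable]: "Z (A p) \<in> borel_measurable M" if "p \<in> I" for p
    using that Am Af by (intro random_variable_Z) (auto simp: I_def)
  note borel_measurable_simple_stable_integral[measurable]
  have "prob {\<omega> \<in> space M. x \<le> \<bar>simple_stable_integral Z g \<omega> - simple_stable_integral Z h \<omega>\<bar>}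
    = prob {\<omega> \<in> space M. x \<le> \<bar>\<Sum>p\<in>I. (fst p - snd p) * Z (A p) \<omega>\<bar>}"
  proof (rule finite_measure_eq_AE)
    show "AE \<omega> in M. (\<omega> \<in> {\<omega> \<in> space M. x \<le> \<bar>simple_stable_integral Z g \<omega> - simple_stable_integral Z h \<omega>\<bar>}) = 
      (\<omega> \<in> {\<omega> \<in> space M. x \<le> \<bar>\<Sum>p\<in>I. (fst p - snd p) * Z (A p) \<omega>\<bar>})"
      using AeG AeH by eventually_elim (simp add: left_diff_distrib sum_subtractf)
  qed (use g h in measurable)
  also have "\<dots> \<le> 2 powr (1 + \<alpha>) * (\<Sum>p\<in>I. \<bar>fst p - snd p\<bar> powr \<alpha> * measure lborel (A p)) * x powr - \<alpha>"
    using \<open>finite I\<close> disj assms Am Af by (intro tail_sum_disjoint) (auto simp: I_def)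
  finally show ?tail by (simp add: eq)
qed

end

section \<open>Tails of general stable integrals\<close>

text \<open>The sum is at most three times the largest term \<open>m\<close>, whose power is one of
  the three on the right. The argument covers every \<open>p > 0\<close> and so avoids
  convexity.\<close>

lemma powr_add3_le:
  fixes a b c p :: real
  assumes "0 \<le> a" "0 \<le> b" "0 \<le> c" "0 < p"
  shows "(a + b + c) powr p \<le> 3 powr p * (a powr p + b powr p + c powr p)"
proof -
  define m where "m = max a (max b c)"
  have "0 \<le> m" using assms by (simp add: m_def)
  have "(a + b + c) powr p \<le> (3 * m) powr p"
    using assms by (intro powr_mono2) (auto simp: m_def)
  also have "\<dots> = 3 powr p * m powr p" using \<open>0 \<le> m\<close> by (simp add: powr_mult)
  also have "m powr p \<le> a powr p + b powr p + c powr p"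
    by (auto simp: m_def max_def)
  finally show ?thesis by simp
qed

lemma integrable_powr_diff:
  fixes f g :: "'a \<Rightarrow> real"
  assumes [measurable]: "f \<in> borel_measurable M" "g \<in> borel_measurable M"
    and "integrable M (\<lambda>s. \<bar>f s\<bar> powr p)" "integrable M (\<lambda>s. \<bar>g s\<bar> powr p)" "0 < p"
  shows "integrable M (\<lambda>s. \<bar>f s - g s\<bar> powr p)"
proof (rule Bochner_Integration.integrable_bound)
  show "integrable M (\<lambda>s. 3 powr p * (\<bar>f s\<bar> powr p + \<bar>g s\<bar> powr p))"
    using assms by auto
  show "AE s in M. norm (\<bar>f s - g s\<bar> powr p) \<le> norm (3 powr p * (\<bar>f s\<bar> powr p + \<bar>g s\<bar> powr p))"
  proof (intro AE_I2)
    fix s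
    have "\<bar>f s - g s\<bar> powr p \<le> (\<bar>f s\<bar> + \<bar>g s\<bar> + 0) powr p"
      using \<open>0 < p\<close> by (intro powr_mono2) auto
    also have "\<dots> \<le> 3 powr p * (\<bar>f s\<bar> powr p + \<bar>g s\<bar> powr p + 0 powr p)"
      using \<open>0 < p\<close> by (intro powr_add3_le) auto
    finally show "norm (\<bar>f s - g s\<bar> powr p) \<le> norm (3 powr p * (\<bar>f s\<bar> powr p + \<bar>g s\<bar> powr p))"
      using \<open>0 < p\<close> by simp
  qed
qed measurable

text \<open>The bound for simple functions carries over to the limit: the approximation errors
  exceed \<open>x / 4\<close> with vanishing probability, and the integral for
  \<open>g n - h n\<close> is controlled by the one for \<open>f1 - f2\<close> plus terms that tend
  to 0.\<close>

lemma (in SaS_random_measure) tail_stable_integral_diff: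
  assumes "0 < \<alpha>" "0 < x"
    and f1: "has_stable_integral M \<alpha> Z f1 Y1" and f2: "has_stable_integral M \<alpha> Z f2 Y2"
  shows "prob {\<omega> \<in> space M. x \<le> \<bar>Y1 \<omega> - Y2 \<omega>\<bar>}
    \<le> 2 * 12 powr \<alpha> * (\<integral>s. \<bar>f1 s - f2 s\<bar> powr \<alpha> \<partial>lborel) * x powr - \<alpha>"
proof -
  have [measurable]: "Y1 \<in> borel_measurable M" "Y2 \<in> borel_measurable M"
      "f1 \<in> borel_measurable borel" "f2 \<in> borel_measurable borel"
    and i1: "integrable lborel (\<lambda>s. \<bar>f1 s\<bar> powr \<alpha>)" and i2: "integrable lborel (\<lambda>s. \<bar>f2 s\<bar> powr \<alpha>)"
    using f1 f2 by (auto simp: has_stable_integral_def)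
  obtain g where g: "\<And>n. simple_function lborel (g n)" "\<And>n. emeasure lborel {s. g n s \<noteq> 0} < \<infinity>"
      and g0: "(\<lambda>n. \<integral>s. \<bar>f1 s - g n s\<bar> powr \<alpha> \<partial>lborel) \<longlonglongrightarrow> 0"
      and gp: "tendsto_in_probability M (\<lambda>n. simple_stable_integral Z (g n)) Y1"
    using f1 unfolding has_stable_integral_def by auto
  obtain h where h: "\<And>n. simple_function lborel (h n)" "\<And>n. emeasure lborel {s. h n s \<noteq> 0} < \<infinity>"
      and h0: "(\<lambda>n. \<integral>s. \<bar>f2 s - h n s\<bar> powr \<alpha> \<partial>lborel) \<longlonglongrightarrow> 0"
      and hp: "tendsto_in_probability M (\<lambda>n. simple_stable_integral Z (h n)) Y2"
    using f2 unfolding has_stable_integral_def by auto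
  have [measurable]: "g n \<in> borel_measurable borel" "h n \<in> borel_measurable borel" for n
    using borel_measurable_simple_function[OF g(1)] borel_measurable_simple_function[OF h(1)] by auto
  have [measurable]: "simple_stable_integral Z (g n) \<in> borel_measurable M" 
      "simple_stable_integral Z (h n) \<in> borel_measurable M" for n
    by (intro borel_measurable_simple_stable_integral g h)+
  let ?I = "\<integral>s. \<bar>f1 s - f2 s\<bar> powr \<alpha> \<partial>lborel"
  let ?a = "\<lambda>n. \<integral>s. \<bar>f1 s - g n s\<bar> powr \<alpha> \<partial>lborel"
  let ?b = "\<lambda>n. \<integral>s. \<bar>f2 s - h n s\<bar> powr \<alpha> \<partial>lborel"
  let ?p = "\<lambda>n. prob {\<omega> \<in> space M. \<bar>simple_stable_integral Z (g n) \<omega> - Y1 \<omega>\<bar> > x / 4}"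
  let ?q = "\<lambda>n. prob {\<omega> \<in> space M. \<bar>simple_stable_integral Z (h n) \<omega> - Y2 \<omega>\<bar> > x / 4}"
  have int_le: "(\<integral>s. \<bar>g n s - h n s\<bar> powr \<alpha> \<partial>lborel) \<le> 3 powr \<alpha> * (?a n + ?I + ?b n)" for n
  proof -
    \<comment> \<open>Comparing \<open>g n\<close> and \<open>h n\<close> with the zero function
      yields the integrability of their own powers from the first part of
      \<open>tail_simple_stable_integral_diff\<close>.\<close>
    have z: "simple_function lborel (\<lambda>_::real. 0::real)" "emeasure lborel {s::real. 0 \<noteq> (0::real)} < \<infinity>"
      by auto
    have ig: "integrable lborel (\<lambda>s. \<bar>g n s\<bar> powr \<alpha>)" "integrable lborel (\<lambda>s. \<bar>h n s\<bar> powr \<alpha>)"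
      using tail_simple_stable_integral_diff(1)[OF \<open>0 < \<alpha>\<close> \<open>0 < x\<close> _ _ z] g h by auto
    have ij: "integrable lborel (\<lambda>s. \<bar>f1 s - g n s\<bar> powr \<alpha>)" "integrable lborel (\<lambda>s. \<bar>f1 s - f2 s\<bar> powr \<alpha>)"
        "integrable lborel (\<lambda>s. \<bar>f2 s - h n s\<bar> powr \<alpha>)" "integrable lborel (\<lambda>s. \<bar>g n s - h n s\<bar> powr \<alpha>)"
      using i1 i2 ig \<open>0 < \<alpha>\<close> by (intro integrable_powr_diff; simp)+
    have "(\<integral>s. \<bar>g n s - h n s\<bar> powr \<alpha> \<partial>lborel) \<le>
       (\<integral>s. 3 powr \<alpha> * (\<bar>f1 s - g n s\<bar> powr \<alpha> + \<bar>f1 s - f2 s\<bar> powr \<alpha> + \<bar>f2 s - h n s\<bar> powr \<alpha>) \<partial>lborel)"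
    proof (intro integral_mono ij)
      fix s
      have "\<bar>g n s - h n s\<bar> powr \<alpha> \<le> (\<bar>f1 s - g n s\<bar> + \<bar>f1 s - f2 s\<bar> + \<bar>f2 s - h n s\<bar>) powr \<alpha>"
        using \<open>0 < \<alpha>\<close> by (intro powr_mono2) auto
      also have "\<dots> \<le> 3 powr \<alpha> * (\<bar>f1 s - g n s\<bar> powr \<alpha> + \<bar>f1 s - f2 s\<bar> powr \<alpha> + \<bar>f2 s - h n s\<bar> powr \<alpha>)"
        using \<open>0 < \<alpha>\<close> by (intro powr_add3_le) auto
      finally show "\<bar>g n s - h n s\<bar> powr \<alpha> \<le> 3 powr \<alpha> * (\<bar>f1 s - g n s\<bar> powr \<alpha> + \<bar>f1 s - f2 s\<bar> powr \<alpha> + \<bar>f2 s - h n s\<bar> powr \<alpha>)" .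
    qed (use ij in auto)
    then show ?thesis using ij by simp
  qed
  have "prob {\<omega> \<in> space M. x \<le> \<bar>Y1 \<omega> - Y2 \<omega>\<bar>} \<le>
      2 powr (1 + \<alpha>) * (3 powr \<alpha> * (?a n + ?I + ?b n)) * (x / 2) powr - \<alpha> + (?p n + ?q n)" for n
  proof -
    let ?d = "\<lambda>\<omega>. simple_stable_integral Z (g n) \<omega> - simple_stable_integral Z (h n) \<omega>"
    have "prob {\<omega> \<in> space M. x \<le> \<bar>Y1 \<omega> - Y2 \<omega>\<bar>} \<le>
       prob ({\<omega> \<in> space M. x / 2 \<le> \<bar>?d \<omega>\<bar>} \<union>
         ({\<omega> \<in> space M. \<bar>simple_stable_integral Z (g n) \<omega> - Y1 \<omega>\<bar> > x / 4} \<union>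
          {\<omega> \<in> space M. \<bar>simple_stable_integral Z (h n) \<omega> - Y2 \<omega>\<bar> > x / 4}))"
    proof (intro finite_measure_mono subsetI)
      fix \<omega> assume *: "\<omega> \<in> {\<omega> \<in> space M. x \<le> \<bar>Y1 \<omega> - Y2 \<omega>\<bar>}"
      \<comment> \<open>The levels are chosen so that \<open>x / 2 + x / 4 + x / 4 = x\<close>. If
        all three alternatives failed, the triangle inequality would give a distance below
        \<open>x\<close>.\<close>
      have "x / 2 \<le> \<bar>?d \<omega>\<bar> \<or> \<bar>simple_stable_integral Z (g n) \<omega> - Y1 \<omega>\<bar> > x / 4 \<or>
          \<bar>simple_stable_integral Z (h n) \<omega> - Y2 \<omega>\<bar> > x / 4"
      proof (rule ccontr)
        assume "\<not> ?thesis"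
        then have "\<bar>?d \<omega>\<bar> < x / 2" "\<bar>simple_stable_integral Z (g n) \<omega> - Y1 \<omega>\<bar> \<le> x / 4"
            "\<bar>simple_stable_integral Z (h n) \<omega> - Y2 \<omega>\<bar> \<le> x / 4" by auto
        moreover have "x \<le> \<bar>Y1 \<omega> - Y2 \<omega>\<bar>" using * by simp
        ultimately show False by linarith
      qed
      with * show "\<omega> \<in> {\<omega> \<in> space M. x / 2 \<le> \<bar>?d \<omega>\<bar>} \<union>
         ({\<omega> \<in> space M. \<bar>simple_stable_integral Z (g n) \<omega> - Y1 \<omega>\<bar> > x / 4} \<union>
          {\<omega> \<in> space M. \<bar>simple_stable_integral Z (h n) \<omega> - Y2 \<omega>\<bar> > x / 4})" by auto
    qed measurable
    also have "\<dots> \<le> prob {\<omega> \<in> space M. x / 2 \<le> \<bar>?d \<omega>\<bar>} + prob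
         ({\<omega> \<in> space M. \<bar>simple_stable_integral Z (g n) \<omega> - Y1 \<omega>\<bar> > x / 4} \<union>
          {\<omega> \<in> space M. \<bar>simple_stable_integral Z (h n) \<omega> - Y2 \<omega>\<bar> > x / 4})"
      by (intro measure_Un_le) measurable
    also have "\<dots> \<le> prob {\<omega> \<in> space M. x / 2 \<le> \<bar>?d \<omega>\<bar>} + (?p n + ?q n)"
      by (intro add_left_mono measure_Un_le) measurable
    also have "prob {\<omega> \<in> space M. x / 2 \<le> \<bar>?d \<omega>\<bar>} \<le>
        2 powr (1 + \<alpha>) * (\<integral>s. \<bar>g n s - h n s\<bar> powr \<alpha> \<partial>lborel) * (x / 2) powr - \<alpha>"
      using assms g h by (intro tail_simple_stable_integral_diff(2)) auto
    also have "\<dots> \<le> 2 powr (1 + \<alpha>) * (3 powr \<alpha> * (?a n + ?I + ?b n)) * (x / 2) powr - \<alpha>"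
      by (intro mult_right_mono mult_left_mono int_le) auto
    finally show ?thesis by simp
  qed
  moreover have "(\<lambda>n. 2 powr (1 + \<alpha>) * (3 powr \<alpha> * (?a n + ?I + ?b n)) * (x / 2) powr - \<alpha> + (?p n + ?q n))
     \<longlonglongrightarrow> 2 powr (1 + \<alpha>) * (3 powr \<alpha> * (0 + ?I + 0)) * (x / 2) powr - \<alpha> + (0 + 0)"
  proof -
    have "?p \<longlonglongrightarrow> 0" "?q \<longlonglongrightarrow> 0"
      using gp[unfolded tendsto_in_probability_def, rule_format, of "x / 4"]
        hp[unfolded tendsto_in_probability_def, rule_format, of "x / 4"] \<open>0 < x\<close> by simp_all
    then show ?thesis by (intro tendsto_add tendsto_mult tendsto_const g0 h0)
  qed
  ultimately have "prob {\<omega> \<in> space M. x \<le> \<bar>Y1 \<omega> - Y2 \<omega>\<bar>} \<le> 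
      2 powr (1 + \<alpha>) * (3 powr \<alpha> * (0 + ?I + 0)) * (x / 2) powr - \<alpha> + (0 + 0)"
    by (intro LIMSEQ_le_const) auto
  also have "\<dots> = 2 * 12 powr \<alpha> * ?I * x powr - \<alpha>"
  proof -
    \<comment> \<open>The three factors are the \<open>2 powr \<alpha>\<close> of the tail bound,
      the \<open>3 powr \<alpha>\<close> of the triangle inequality and the
      \<open>2 powr \<alpha>\<close> from halving \<open>x\<close>.\<close>
    have "(12::real) powr \<alpha> = 2 powr \<alpha> * 3 powr \<alpha> * 2 powr \<alpha>"
      by (simp flip: powr_mult)
    then show ?thesis
      using \<open>0 < x\<close> by (simp add: powr_divide powr_add powr_minus field_simps)
  qed
  finally show ?thesis .
qed

section \<open>Self-similarity of the kernel\<close>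

text \<open>Substitute \<open>s = t' + h * v\<close> with \<open>h = t - t'\<close>. The terms in
  \<open>max 0 (- s)\<close> cancel in the increment, homogeneity of degree
  \<open>H - 1/\<alpha>\<close> releases a power of \<open>h\<close>, and the Jacobian adds one more
  factor \<open>h\<close>, so the total exponent is
  \<open>1 + \<alpha> * (H - 1/\<alpha>) = \<alpha> * H\<close>.\<close>

lemma lfsm_kernel_increment_norm:
  assumes "0 < \<alpha>" "t' < t"
  shows "(\<integral>s. \<bar>lfsm_kernel H \<alpha> t s - lfsm_kernel H \<alpha> t' s\<bar> powr \<alpha> \<partial>lborel)
    = (t - t') powr (\<alpha> * H) * (\<integral>s. \<bar>lfsm_kernel H \<alpha> 1 s\<bar> powr \<alpha> \<partial>lborel)"
proof -
  define h where "h = t - t'"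
  have "h > 0" using assms by (simp add: h_def)
  have mx: "max 0 (h * z) = h * max 0 z" for z
    using \<open>h > 0\<close> by (simp add: max_mult_distrib_left)
  have k: "\<bar>lfsm_kernel H \<alpha> t (t' + h * v) - lfsm_kernel H \<alpha> t' (t' + h * v)\<bar> powr \<alpha>
    = h powr (\<alpha> * (H - 1 / \<alpha>)) * \<bar>lfsm_kernel H \<alpha> 1 v\<bar> powr \<alpha>" for v
  proof -
    have "t - (t' + h * v) = h * (1 - v)" "t' - (t' + h * v) = h * (- v)"
      by (simp_all add: h_def algebra_simps)
    then have "lfsm_kernel H \<alpha> t (t' + h * v) - lfsm_kernel H \<alpha> t' (t' + h * v)
      = max 0 (h * (1 - v)) powr (H - 1/\<alpha>) - max 0 (h * (- v)) powr (H - 1/\<alpha>)"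
      by (simp only: lfsm_kernel_def)
    also have "\<dots> = h powr (H - 1 / \<alpha>) * lfsm_kernel H \<alpha> 1 v"
      unfolding mx using \<open>h > 0\<close> by (simp add: lfsm_kernel_def powr_mult algebra_simps)
    finally show ?thesis
      using \<open>h > 0\<close> by (simp add: abs_mult powr_mult powr_powr mult.commute)
  qed
  have "(\<integral>s. \<bar>lfsm_kernel H \<alpha> t s - lfsm_kernel H \<alpha> t' s\<bar> powr \<alpha> \<partial>lborel)
      = h * (h powr (\<alpha> * (H - 1 / \<alpha>)) * (\<integral>s. \<bar>lfsm_kernel H \<alpha> 1 s\<bar> powr \<alpha> \<partial>lborel))"
    using \<open>h > 0\<close>
    by (subst lborel_integral_real_affine[where c=h and t=t']) (simp_all add: k)
  also have "h * (h powr (\<alpha> * (H - 1 / \<alpha>)) * c) = h powr (1 + \<alpha> * (H - 1 / \<alpha>)) * c" for c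
    using \<open>h > 0\<close> by (simp add: powr_add)
  also have "1 + \<alpha> * (H - 1 / \<alpha>) = \<alpha> * H" using assms by (simp add: algebra_simps)
  finally show ?thesis by (simp add: h_def)
qed

section \<open>Averages of variables with power tails\<close>

text \<open>Dyadic layers: where \<open>Y\<close> lies between \<open>2 ^ n * a\<close> and
  \<open>2 ^ Suc n * a\<close> it is bounded by the upper end, and the tail hypothesis bounds the
  probability of exceeding the lower end. The resulting series is geometric with ratio
  \<open>2 powr (1 - \<alpha>)\<close>, which is below 1 because
  \<open>1 < \<alpha>\<close>.\<close>

lemma (in prob_space) truncated_moment_bound:
  fixes Y :: "'a \<Rightarrow> real"
  assumes [measurable]: "random_variable borel Y"
    and tail: "\<And>x. 0 < x \<Longrightarrow> prob {\<omega> \<in> space M. x \<le> Y \<omega>} \<le> c * x powr - \<alpha>"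
    and "1 < \<alpha>" "0 < a" "0 \<le> c"
  shows "(\<integral>\<^sup>+\<omega>. ennreal (Y \<omega>) * indicator {\<omega>. a \<le> Y \<omega>} \<omega> \<partial>M)
    \<le> ennreal (2 / (1 - 2 powr (1 - \<alpha>)) * c * a powr (1 - \<alpha>))"
proof -
  let ?A = "\<lambda>n. {\<omega> \<in> space M. 2 ^ n * a \<le> Y \<omega>}"
  have "(\<integral>\<^sup>+\<omega>. ennreal (Y \<omega>) * indicator {\<omega>. a \<le> Y \<omega>} \<omega> \<partial>M)
      \<le> (\<integral>\<^sup>+\<omega>. (\<Sum>n. ennreal (2 ^ Suc n * a) * indicator (?A n) \<omega>) \<partial>M)"
  proof (intro nn_integral_mono)
    fix \<omega> assume \<omega>: "\<omega> \<in> space M"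
    show "ennreal (Y \<omega>) * indicator {\<omega>. a \<le> Y \<omega>} \<omega> \<le> (\<Sum>n. ennreal (2 ^ Suc n * a) * indicator (?A n) \<omega>)"
    proof (cases "a \<le> Y \<omega>")
      case True
      \<comment> \<open>The index \<open>m\<close> is positive since
        \<open>a \<le> Y \<omega>\<close>. Its predecessor \<open>k\<close> is the layer that
        contains \<open>Y \<omega>\<close>, and the \<open>k\<close>-th term alone
        dominates.\<close>
      define m where "m = (LEAST n. Y \<omega> < 2 ^ n * a)"
      obtain n :: nat where "Y \<omega> / a < 2 ^ n" using real_arch_pow[of 2 "Y \<omega> / a"] by auto
      then have "Y \<omega> < 2 ^ n * a" using \<open>0 < a\<close> by (simp add: field_simps)
      then have m: "Y \<omega> < 2 ^ m * a" unfolding m_def by (rule LeastI)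
      with True have "m \<noteq> 0" by (auto intro: Nat.gr0I)
      then obtain k where k: "m = Suc k" by (cases m) auto
      then have "\<not> Y \<omega> < 2 ^ k * a" unfolding m_def by (intro not_less_Least) auto
      then have "ennreal (Y \<omega>) * indicator {\<omega>. a \<le> Y \<omega>} \<omega> \<le> ennreal (2 ^ Suc k * a) * indicator (?A k) \<omega>"
        using m k True \<omega> by (auto intro!: ennreal_leI)
      also have "\<dots> = (\<Sum>n\<in>{k}. ennreal (2 ^ Suc n * a) * indicator (?A n) \<omega>)"
        by (subst sum.insert) auto
      also have "\<dots> \<le> (\<Sum>n. ennreal (2 ^ Suc n * a) * indicator (?A n) \<omega>)"
        by (intro sum_le_suminf) auto
      finally show ?thesis .
    qed simp
  qed
  also have "\<dots> = (\<Sum>n. \<integral>\<^sup>+\<omega>. ennreal (2 ^ Suc n * a) * indicator (?A n) \<omega> \<partial>M)"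
    by (intro nn_integral_suminf) measurable
  also have "\<dots> = (\<Sum>n. ennreal (2 ^ Suc n * a * prob (?A n)))"
    using \<open>0 < a\<close> by (simp add: nn_integral_cmult_indicator emeasure_eq_measure ennreal_mult)
  also have "\<dots> \<le> (\<Sum>n. ennreal (2 * c * a powr (1 - \<alpha>) * (2 powr (1 - \<alpha>)) ^ n))"
  proof (intro suminf_le ennreal_leI)
    fix n
    have "2 ^ Suc n * a * prob (?A n) \<le> 2 ^ Suc n * a * (c * (2 ^ n * a) powr - \<alpha>)"
      using \<open>0 < a\<close> by (intro mult_left_mono tail) auto
    also have "\<dots> = 2 * c * a powr (1 - \<alpha>) * (2 powr (1 - \<alpha>)) ^ n"
      using \<open>0 < a\<close> 
      by (simp add: powr_mult powr_diff powr_minus powr_realpow[symmetric] powr_powr field_simps)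
    finally show "2 ^ Suc n * a * prob (?A n) \<le> 2 * c * a powr (1 - \<alpha>) * (2 powr (1 - \<alpha>)) ^ n" .
  qed auto
  also have "\<dots> = ennreal (2 * c * a powr (1 - \<alpha>) * (1 / (1 - 2 powr (1 - \<alpha>))))"
  proof (rule suminf_ennreal_eq)
    have "(2::real) powr (1 - \<alpha>) < 2 powr 0" using \<open>1 < \<alpha>\<close> by (intro powr_less_mono) auto
    then show "(\<lambda>n. 2 * c * a powr (1 - \<alpha>) * (2 powr (1 - \<alpha>)) ^ n) sums
       (2 * c * a powr (1 - \<alpha>) * (1 / (1 - 2 powr (1 - \<alpha>))))"
      by (intro sums_mult geometric_sums) simp
  qed (use assms in auto)
  finally show ?thesis by (simp add: mult_ac)
qed

text \<open>Split \<open>F \<le> \<lambda>/2 + F 1\<^bsub>{F \<ge> \<lambda>/2}\<^esub>\<close> and apply Markov's inequality to the second part.\<close>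

lemma (in prob_space) tail_average:
  fixes F :: "real \<Rightarrow> 'a \<Rightarrow> real"
  assumes F[measurable]: "(\<lambda>(u, \<omega>). F u \<omega>) \<in> borel_measurable (borel \<Otimes>\<^sub>M M)"
    and tail: "\<And>u x. u \<in> {0..1} \<Longrightarrow> 0 < x \<Longrightarrow> prob {\<omega> \<in> space M. x \<le> F u \<omega>} \<le> c * x powr - \<alpha>"
    and "1 < \<alpha>" "0 < l" "0 \<le> c"
  shows "{\<omega> \<in> space M. ennreal l \<le> (\<integral>\<^sup>+u\<in>{0..1}. ennreal (F u \<omega>) \<partial>lborel)} \<in> events" (is "?A \<in> _")
    and "prob {\<omega> \<in> space M. ennreal l \<le> (\<integral>\<^sup>+u\<in>{0..1}. ennreal (F u \<omega>) \<partial>lborel)}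
      \<le> 2 / (1 - 2 powr (1 - \<alpha>)) * 2 powr \<alpha> * c * l powr - \<alpha>"
proof -
  interpret pair_sigma_finite lborel M ..
  show A: "?A \<in> events" by measurable
  define C where "C = 2 / (1 - 2 powr (1 - \<alpha>))"
  have "(2::real) powr (1 - \<alpha>) < 2 powr 0" using \<open>1 < \<alpha>\<close> by (intro powr_less_mono) auto
  then have "0 \<le> C" by (simp add: C_def)
  \<comment> \<open>The part of \<open>F\<close> at or above \<open>l / 2\<close>, to which
    \<open>truncated_moment_bound\<close> applies with \<open>a = l / 2\<close>.\<close>
  define G where "G = (\<lambda>u \<omega>. ennreal (F u \<omega>) * indicator {\<omega>. l / 2 \<le> F u \<omega>} \<omega>)"
  have Gm[measurable]: "(\<lambda>(u, \<omega>). G u \<omega>) \<in> borel_measurable (borel \<Otimes>\<^sub>M M)"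
    unfolding G_def by (simp add: indicator_def mem_Collect_eq) measurable
  have "ennreal (l / 2) * emeasure M ?A \<le> (\<integral>\<^sup>+\<omega>. (\<integral>\<^sup>+u\<in>{0..1}. G u \<omega> \<partial>lborel) \<partial>M)"
  proof -
    have "ennreal (l / 2) * emeasure M ?A = (\<integral>\<^sup>+\<omega>. ennreal (l / 2) * indicator ?A \<omega> \<partial>M)"
      using A by (simp add: nn_integral_cmult_indicator)
    also have "\<dots> \<le> (\<integral>\<^sup>+\<omega>. (\<integral>\<^sup>+u\<in>{0..1}. G u \<omega> \<partial>lborel) \<partial>M)"
    proof (intro nn_integral_mono)
      fix \<omega> assume \<omega>[measurable]: "\<omega> \<in> space M"
      show "ennreal (l / 2) * indicator ?A \<omega> \<le> (\<integral>\<^sup>+u\<in>{0..1}. G u \<omega> \<partial>lborel)"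
      proof (cases "\<omega> \<in> ?A")
        case True
        have [measurable]: "(\<lambda>u. F u \<omega>) \<in> borel_measurable borel" "(\<lambda>u. G u \<omega>) \<in> borel_measurable borel" 
          by measurable
        have "ennreal (l / 2) + ennreal (l / 2) = ennreal l"
          using \<open>0 < l\<close> by (subst ennreal_plus[symmetric]) auto
        also have "\<dots> \<le> (\<integral>\<^sup>+u\<in>{0..1}. ennreal (F u \<omega>) \<partial>lborel)" using True by simp
        \<comment> \<open>Below \<open>l / 2\<close> the constant dominates \<open>F\<close>, and
          elsewhere \<open>G\<close> equals \<open>F\<close>. As \<open>{0..1}\<close> has length 1,
          the constant integrates to \<open>l / 2\<close>, which cancels against half of
          \<open>l\<close>.\<close>
        also have "\<dots> \<le> (\<integral>\<^sup>+u. ennreal (l / 2) * indicator {0..1::real} u + G u \<omega> * indicator {0..1} u \<partial>lborel)"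
          by (intro nn_integral_mono) (auto simp: G_def split: split_indicator intro!: ennreal_leI)
        also have "\<dots> = ennreal (l / 2) + (\<integral>\<^sup>+u\<in>{0..1}. G u \<omega> \<partial>lborel)"
          by (subst nn_integral_add) (auto simp: nn_integral_cmult_indicator)
        finally show ?thesis using True by (simp add: ennreal_add_left_cancel_le)
      qed simp
    qed
    finally show ?thesis .
  qed
  also have "\<dots> = (\<integral>\<^sup>+u. \<integral>\<^sup>+\<omega>. G u \<omega> * indicator {0..1} u \<partial>M \<partial>lborel)"
    by (rule Fubini') measurable
  also have "\<dots> \<le> (\<integral>\<^sup>+u. ennreal (C * c * (l / 2) powr (1 - \<alpha>)) * indicator {0..1::real} u \<partial>lborel)"
  proof (intro nn_integral_mono)
    fix u :: real
    have [measurable]: "F u \<in> borel_measurable M" by measurable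
    show "(\<integral>\<^sup>+\<omega>. G u \<omega> * indicator {0..1} u \<partial>M) \<le> ennreal (C * c * (l / 2) powr (1 - \<alpha>)) * indicator {0..1} u"
      using truncated_moment_bound[of "F u" c \<alpha> "l / 2"] tail assms
      by (auto simp: G_def C_def split: split_indicator)
  qed
  also have "\<dots> = ennreal (C * c * (l / 2) powr (1 - \<alpha>))"
    by (simp add: nn_integral_cmult_indicator)
  finally have "ennreal (l / 2 * prob ?A) \<le> ennreal (C * c * (l / 2) powr (1 - \<alpha>))"
    using \<open>0 < l\<close> by (simp add: emeasure_eq_measure ennreal_mult[symmetric])
  then have "l / 2 * prob ?A \<le> C * c * (l / 2) powr (1 - \<alpha>)"
    using \<open>0 \<le> C\<close> \<open>0 \<le> c\<close> by (subst (asm) ennreal_le_iff) auto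
  then have "prob ?A \<le> C * c * (l / 2) powr (1 - \<alpha>) / (l / 2)"
    using \<open>0 < l\<close> by (simp add: field_simps)
  \<comment> \<open>Dividing by \<open>l / 2\<close> leaves \<open>(l / 2) powr - \<alpha>\<close>,
    the origin of the factor \<open>2 powr \<alpha>\<close>.\<close>
  also have "\<dots> = C * 2 powr \<alpha> * c * l powr - \<alpha>"
    using \<open>0 < l\<close> by (simp add: powr_diff powr_divide powr_minus field_simps)
  finally show "prob ?A \<le> 2 / (1 - 2 powr (1 - \<alpha>)) * 2 powr \<alpha> * c * l powr - \<alpha>"
    by (simp add: C_def)
qed

section \<open>Joint measurability and the pathwise bound\<close>

text \<open>Rounding the time down to the grid of mesh \<open>1 / real (Suc n)\<close> gives a
  process that is jointly measurable, since only countably many times occur. By continuity of the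
  paths these processes converge pointwise to \<open>X\<close>.\<close>

lemma borel_measurable_continuous_process:
  fixes X :: "real \<Rightarrow> 'a \<Rightarrow> real"
  assumes X: "\<And>t. X t \<in> borel_measurable M"
    and cont: "\<And>\<omega>. \<omega> \<in> space M \<Longrightarrow> continuous_on UNIV (\<lambda>t. X t \<omega>)"
  shows "(\<lambda>(t, \<omega>). X t \<omega>) \<in> borel_measurable (borel \<Otimes>\<^sub>M M)"
proof (rule borel_measurable_LIMSEQ_real)
  fix n :: nat
  have "(\<lambda>p. X (real_of_int \<lfloor>real (Suc n) * fst p\<rfloor> / real (Suc n)) (snd p)) \<in> borel_measurable (borel \<Otimes>\<^sub>M M)"
    by (rule measurable_compose_countable[where f="\<lambda>i p. X (real_of_int i / real (Suc n)) (snd p)"])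
       (auto intro: measurable_compose[OF measurable_snd X])
  then show "(\<lambda>(t, \<omega>). X (real_of_int \<lfloor>real (Suc n) * t\<rfloor> / real (Suc n)) \<omega>) \<in> borel_measurable (borel \<Otimes>\<^sub>M M)"
    by (simp add: split_beta)
next
  fix p :: "real \<times> 'a" assume "p \<in> space (borel \<Otimes>\<^sub>M M)"
  then have \<omega>: "snd p \<in> space M" by (auto simp: space_pair_measure)
  have "(\<lambda>n. real_of_int \<lfloor>real (Suc n) * fst p\<rfloor> / real (Suc n)) \<longlonglongrightarrow> fst p"
  proof (rule real_tendsto_sandwich)
    have "(\<lambda>n. fst p - 1 / real (Suc n)) \<longlonglongrightarrow> fst p - 0"
      by (intro tendsto_diff tendsto_const LIMSEQ_Suc lim_1_over_n)
    then show "(\<lambda>n. fst p - 1 / real (Suc n)) \<longlonglongrightarrow> fst p" by simp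
    show "\<forall>\<^sub>F n in sequentially. fst p - 1 / real (Suc n) \<le> real_of_int \<lfloor>real (Suc n) * fst p\<rfloor> / real (Suc n)"
    proof (intro always_eventually allI)
      fix n
      have "real (Suc n) * fst p - 1 \<le> real_of_int \<lfloor>real (Suc n) * fst p\<rfloor>" by linarith
      then have "(real (Suc n) * fst p - 1) / real (Suc n) \<le> real_of_int \<lfloor>real (Suc n) * fst p\<rfloor> / real (Suc n)"
        by (intro divide_right_mono) auto
      then show "fst p - 1 / real (Suc n) \<le> real_of_int \<lfloor>real (Suc n) * fst p\<rfloor> / real (Suc n)"
        by (simp add: diff_divide_distrib)
    qed
    show "\<forall>\<^sub>F n in sequentially. real_of_int \<lfloor>real (Suc n) * fst p\<rfloor> / real (Suc n) \<le> fst p"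
    proof (intro always_eventually allI)
      fix n
      have "real_of_int \<lfloor>real (Suc n) * fst p\<rfloor> / real (Suc n) \<le> (real (Suc n) * fst p) / real (Suc n)"
        by (intro divide_right_mono) auto
      then show "real_of_int \<lfloor>real (Suc n) * fst p\<rfloor> / real (Suc n) \<le> fst p" by simp
    qed
  qed simp
  then have "(\<lambda>n. X (real_of_int \<lfloor>real (Suc n) * fst p\<rfloor> / real (Suc n)) (snd p)) \<longlonglongrightarrow> X (fst p) (snd p)"
    by (rule continuous_on_tendsto_compose[OF cont[OF \<omega>]]) auto
  then show "(\<lambda>n. case p of (t, \<omega>) \<Rightarrow> X (real_of_int \<lfloor>real (Suc n) * t\<rfloor> / real (Suc n)) \<omega>)
      \<longlonglongrightarrow> (case p of (t, \<omega>) \<Rightarrow> X t \<omega>)"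
    by (simp add: split_beta)
qed

text \<open>The substitution \<open>t = (k + u) / 2 ^ j\<close> cancels the factor
  \<open>2 ^ j\<close>, and since \<open>\<psi>\<close> integrates to 0 the value of the path at
  \<open>k / 2 ^ j\<close> can be subtracted for free.\<close>

lemma wavelet_coeff_le:
  fixes \<psi> :: "real \<Rightarrow> real"
  assumes X: "continuous_on UNIV (\<lambda>t. X t \<omega>)" and \<psi>: "continuous_on UNIV \<psi>"
    and supp: "\<And>s. s \<notin> {0..1} \<Longrightarrow> \<psi> s = 0" and zero: "(\<integral>s. \<psi> s \<partial>lborel) = 0"
    and B: "\<And>s. \<bar>\<psi> s\<bar> \<le> B"
  shows "ennreal \<bar>wavelet_coeff X \<psi> j k \<omega>\<bar>
    \<le> (\<integral>\<^sup>+u\<in>{0..1}. ennreal (B * \<bar>X (real k / 2 ^ j + u / 2 ^ j) \<omega> - X (real k / 2 ^ j) \<omega>\<bar>) \<partial>lborel)"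
proof -
  let ?x = "\<lambda>u. X (real k / 2 ^ j + u / 2 ^ j) \<omega>"
  let ?y = "X (real k / 2 ^ j) \<omega>"
  \<comment> \<open>The product is continuous on \<open>{0..1}\<close> and vanishes outside, so it
    is integrable for any continuous \<open>f\<close>, bounded or not.\<close>
  have int: "integrable lborel (\<lambda>u. f u * \<psi> u)" if "continuous_on UNIV f" for f :: "real \<Rightarrow> real"
  proof -
    have "set_integrable lborel {0..1} (\<lambda>u. f u * \<psi> u)"
      by (intro borel_integrable_atLeastAtMost' continuous_on_mult 
            continuous_on_subset[OF that] continuous_on_subset[OF \<psi>]) auto
    moreover have "(\<lambda>u. indicator {0..1} u *\<^sub>R (f u * \<psi> u)) = (\<lambda>u. f u * \<psi> u)"
      using supp by (auto simp: fun_eq_iff split: split_indicator)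
    ultimately show ?thesis by (simp add: set_integrable_def)
  qed
  have xc: "continuous_on UNIV ?x"
    by (rule continuous_on_compose2[OF X]) (auto intro!: continuous_intros)
  have "wavelet_coeff X \<psi> j k \<omega> = (\<integral>u. ?x u * \<psi> u \<partial>lborel)"
    unfolding wavelet_coeff_def
    by (subst lborel_integral_real_affine[where c="1 / 2 ^ j" and t="real k / 2 ^ j"])
       (simp_all add: distrib_left)
  also have "\<dots> = (\<integral>u. ?x u * \<psi> u - ?y * \<psi> u \<partial>lborel)"
    using int[OF xc] int[of "\<lambda>_. ?y"] zero by simp
  finally have "ennreal \<bar>wavelet_coeff X \<psi> j k \<omega>\<bar> = ennreal (norm (\<integral>u. ?x u * \<psi> u - ?y * \<psi> u \<partial>lborel))"
    by simp
  also have "\<dots> \<le> (\<integral>\<^sup>+u. ennreal (norm (?x u * \<psi> u - ?y * \<psi> u)) \<partial>lborel)"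
    using int[OF xc] int[of "\<lambda>_. ?y"]
    by (intro integral_norm_bound_ennreal Bochner_Integration.integrable_diff) auto
  also have "\<dots> \<le> (\<integral>\<^sup>+u\<in>{0..1}. ennreal (B * \<bar>?x u - ?y\<bar>) \<partial>lborel)"
  proof (intro nn_integral_mono)
    fix u
    have "norm (?x u * \<psi> u - ?y * \<psi> u) = \<bar>\<psi> u\<bar> * \<bar>?x u - ?y\<bar>"
      by (simp add: abs_mult[symmetric] algebra_simps)
    also have "\<dots> \<le> B * \<bar>?x u - ?y\<bar>" by (intro mult_right_mono B) simp
    finally have "norm (?x u * \<psi> u - ?y * \<psi> u) \<le> B * \<bar>?x u - ?y\<bar>" .
    then show "ennreal (norm (?x u * \<psi> u - ?y * \<psi> u)) \<le> ennreal (B * \<bar>?x u - ?y\<bar>) * indicator {0..1} u"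
      using supp[of u] by (auto split: split_indicator intro: ennreal_leI)
  qed
  finally show ?thesis .
qed

section \<open>Tail of the maximal coefficient at one scale\<close>

text \<open>The covering event \<open>E\<close> spares a measurability proof for \<open>wavelet_max\<close>.\<close>

lemma (in SaS_random_measure) wavelet_max_tail:
  assumes "1 < \<alpha>" "0 < H"
    and X: "is_lfsm M H \<alpha> Z X"
    and \<psi>: "continuous_on UNIV \<psi>"
    and supp: "\<And>s. s \<notin> {0..1} \<Longrightarrow> \<psi> s = 0" and zero: "(\<integral>s. \<psi> s \<partial>lborel) = 0"
  shows "\<exists>C\<ge>0. \<forall>j. \<forall>l>0. \<exists>E\<in>events. {\<omega> \<in> space M. l \<le> wavelet_max X \<psi> j \<omega>} \<subseteq> E \<and>
    prob E \<le> C * 2 powr (real j * (1 - \<alpha> * H)) * l powr - \<alpha>"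
proof -
  have Xi: "has_stable_integral M \<alpha> Z (lfsm_kernel H \<alpha> t) (X t)" for t
    using X by (auto simp: is_lfsm_def)
  have Xc: "continuous_on UNIV (\<lambda>t. X t \<omega>)" if "\<omega> \<in> space M" for \<omega>
    using X that by (auto simp: is_lfsm_def)
  from Xi have [measurable]: "X t \<in> borel_measurable M" for t by (auto simp: has_stable_integral_def)
  have XX[measurable]: "(\<lambda>(t, \<omega>). X t \<omega>) \<in> borel_measurable (borel \<Otimes>\<^sub>M M)"
    by (intro borel_measurable_continuous_process Xc) auto
  have "bounded (\<psi> ` {0..1})"
    by (intro compact_imp_bounded compact_continuous_image continuous_on_subset[OF \<psi>]) auto
  then obtain B where "0 < B" and B01: "\<And>s. s \<in> {0..1} \<Longrightarrow> \<bar>\<psi> s\<bar> \<le> B"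
    unfolding bounded_pos by auto
  then have B: "\<bar>\<psi> s\<bar> \<le> B" for s using supp[of s] by (cases "s \<in> {0..1}") auto
  define \<kappa> where "\<kappa> = (\<integral>s. \<bar>lfsm_kernel H \<alpha> 1 s\<bar> powr \<alpha> \<partial>lborel)"
  have "0 \<le> \<kappa>" by (simp add: \<kappa>_def)
  \<comment> \<open>The factor \<open>2 * 12 powr \<alpha> * \<kappa>\<close> comes from
    \<open>tail_stable_integral_diff\<close> and the norm of the kernel at time 1. The factor
    \<open>B powr \<alpha>\<close> appears because \<open>x \<le> F j k u \<omega>\<close> means an
    increment of size at least \<open>x / B\<close>.\<close>
  define C0 where "C0 = 2 * 12 powr \<alpha> * \<kappa> * B powr \<alpha>"
  define c where "c = (\<lambda>j. C0 * 2 powr - (real j * (\<alpha> * H)))"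
  have "0 \<le> C0" using \<open>0 \<le> \<kappa>\<close> by (simp add: C0_def)
  define F where "F = (\<lambda>j k u \<omega>. B * \<bar>X (real k / 2 ^ j + u / 2 ^ j) \<omega> - X (real k / 2 ^ j) \<omega>\<bar>)"
  have Fm: "(\<lambda>(u, \<omega>). F j k u \<omega>) \<in> borel_measurable (borel \<Otimes>\<^sub>M M)" for j k
  proof -
    have "(\<lambda>p. (real k / 2 ^ j + fst p / 2 ^ j, snd p)) \<in> borel \<Otimes>\<^sub>M M \<rightarrow>\<^sub>M borel \<Otimes>\<^sub>M M"
      by measurable
    from measurable_compose[OF this XX]
    have [measurable]: "(\<lambda>p. X (real k / 2 ^ j + fst p / 2 ^ j) (snd p)) \<in> borel_measurable (borel \<Otimes>\<^sub>M M)"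
      by simp
    show ?thesis unfolding F_def split_beta by measurable
  qed
  have Ft: "prob {\<omega> \<in> space M. x \<le> F j k u \<omega>} \<le> c j * x powr - \<alpha>" if u: "u \<in> {0..1}" and "0 < x" for j k u x
  proof -
    let ?t = "real k / 2 ^ j + u / 2 ^ j" and ?t' = "real k / 2 ^ j"
    let ?N = "\<integral>s. \<bar>lfsm_kernel H \<alpha> ?t s - lfsm_kernel H \<alpha> ?t' s\<bar> powr \<alpha> \<partial>lborel"
    have "{\<omega> \<in> space M. x \<le> F j k u \<omega>} = {\<omega> \<in> space M. x / B \<le> \<bar>X ?t \<omega> - X ?t' \<omega>\<bar>}"
      using \<open>0 < B\<close> by (simp add: F_def field_simps)
    then have "prob {\<omega> \<in> space M. x \<le> F j k u \<omega>} \<le> 2 * 12 powr \<alpha> * ?N * (x / B) powr - \<alpha>"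
      using tail_stable_integral_diff[OF _ _ Xi Xi, of "x / B" ?t ?t'] assms \<open>0 < B\<close> \<open>0 < x\<close> by simp
    also have "\<dots> \<le> 2 * 12 powr \<alpha> * (2 powr - (real j * (\<alpha> * H)) * \<kappa>) * (x / B) powr - \<alpha>"
    proof (intro mult_right_mono mult_left_mono)
      show "?N \<le> 2 powr - (real j * (\<alpha> * H)) * \<kappa>"
      \<comment> \<open>The scaling identity requires \<open>t' < t\<close>, that is
        \<open>u > 0\<close>. For \<open>u = 0\<close> the two kernels coincide and the integral is
        0.\<close>
      proof (cases "u = 0")
        case False
        then have "?N = (u / 2 ^ j) powr (\<alpha> * H) * \<kappa>"
          using u assms by (subst lfsm_kernel_increment_norm) (auto simp: \<kappa>_def)
        also have "(u / 2 ^ j) powr (\<alpha> * H) \<le> (1 / 2 ^ j) powr (\<alpha> * H)"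
          using u assms by (intro powr_mono2 divide_right_mono) auto
        also have "\<dots> = 2 powr - (real j * (\<alpha> * H))"
          by (simp add: powr_divide powr_minus powr_realpow[symmetric] powr_powr field_simps)
        finally show ?thesis using \<open>0 \<le> \<kappa>\<close> by (simp add: mult_right_mono)
      qed (use \<open>0 \<le> \<kappa>\<close> in simp)
    qed auto
    also have "\<dots> = c j * x powr - \<alpha>"
      using \<open>0 < B\<close> \<open>0 < x\<close> by (simp add: c_def C0_def powr_divide powr_minus field_simps)
    finally show ?thesis .
  qed
  define C where "C = 2 / (1 - 2 powr (1 - \<alpha>)) * 2 powr \<alpha> * C0"
  have "(2::real) powr (1 - \<alpha>) < 2 powr 0" using \<open>1 < \<alpha>\<close> by (intro powr_less_mono) auto
  then have "0 \<le> C" using \<open>0 \<le> C0\<close> by (simp add: C_def)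
  define A where "A = (\<lambda>j l k. {\<omega> \<in> space M. ennreal l \<le> (\<integral>\<^sup>+u\<in>{0..1}. ennreal (F j k u \<omega>) \<partial>lborel)})"
  have cj: "0 \<le> c j" for j using \<open>0 \<le> C0\<close> by (simp add: c_def)
  have Am: "A j l k \<in> events" if "0 < l" for j l k
    unfolding A_def using Fm Ft \<open>1 < \<alpha>\<close> that cj by (rule tail_average(1))
  have At: "prob (A j l k) \<le> C * 2 powr - (real j * (\<alpha> * H)) * l powr - \<alpha>" if "0 < l" for j l k
  proof -
    have "prob (A j l k) \<le> 2 / (1 - 2 powr (1 - \<alpha>)) * 2 powr \<alpha> * c j * l powr - \<alpha>"
      unfolding A_def using Fm Ft \<open>1 < \<alpha>\<close> that cj by (rule tail_average(2))
    then show ?thesis by (simp add: C_def c_def)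
  qed
  have "\<exists>E\<in>events. {\<omega> \<in> space M. l \<le> wavelet_max X \<psi> j \<omega>} \<subseteq> E \<and>
      prob E \<le> C * 2 powr (real j * (1 - \<alpha> * H)) * l powr - \<alpha>" if "0 < l" for j l
  proof (intro bexI conjI)
    let ?E = "\<Union>k\<in>{0..<2 ^ j}. A j l k"
    show "?E \<in> events" using Am[OF that] by auto
    show "{\<omega> \<in> space M. l \<le> wavelet_max X \<psi> j \<omega>} \<subseteq> ?E"
    proof safe
      fix \<omega> assume \<omega>: "\<omega> \<in> space M" and "l \<le> wavelet_max X \<psi> j \<omega>"
      moreover have "wavelet_max X \<psi> j \<omega> \<in> (\<lambda>k. \<bar>wavelet_coeff X \<psi> j k \<omega>\<bar>) ` {0..<2 ^ j}"
        unfolding wavelet_max_def by (intro Max_in) auto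
      ultimately obtain k where k: "k \<in> {0..<2 ^ j}" "l \<le> \<bar>wavelet_coeff X \<psi> j k \<omega>\<bar>" by auto
      have "ennreal l \<le> ennreal \<bar>wavelet_coeff X \<psi> j k \<omega>\<bar>" using k by (intro ennreal_leI)
      also have "\<dots> \<le> (\<integral>\<^sup>+u\<in>{0..1}. ennreal (F j k u \<omega>) \<partial>lborel)"
        unfolding F_def using Xc[OF \<omega>] \<psi> supp zero B by (rule wavelet_coeff_le)
      finally show "\<omega> \<in> ?E" using \<omega> k(1) by (auto simp: A_def)
    qed
    have "prob ?E \<le> (\<Sum>k\<in>{0..<2 ^ j}. prob (A j l k))"
      using Am[OF that] by (intro measure_UNION_le) auto
    also have "\<dots> \<le> (\<Sum>k\<in>{0..<2 ^ j::nat}. C * 2 powr - (real j * (\<alpha> * H)) * l powr - \<alpha>)"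
      by (intro sum_mono At that)
    \<comment> \<open>The \<open>2 ^ j\<close> equal summands raise the exponent of 2 from
      \<open>- (real j * (\<alpha> * H))\<close> to
      \<open>real j * (1 - \<alpha> * H)\<close>.\<close>
    also have "\<dots> = C * 2 powr (real j * (1 - \<alpha> * H)) * l powr - \<alpha>"
      by (simp add: powr_realpow[symmetric] right_diff_distrib powr_diff powr_minus field_simps)
    finally show "prob ?E \<le> C * 2 powr (real j * (1 - \<alpha> * H)) * l powr - \<alpha>" .
  qed
  with \<open>0 \<le> C\<close> show ?thesis by (intro exI[of _ C] conjI allI impI)
qed

section \<open>Borel-Cantelli for countably many exponents\<close>

theorem mainTheorem3:
  fixes M :: "'a measure" and Z :: "real set \<Rightarrow> 'a \<Rightarrow> real"
    and X :: "real \<Rightarrow> 'a \<Rightarrow> real" and \<psi> :: "real \<Rightarrow> real" and H \<alpha> :: real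
  assumes "1 < \<alpha>" and "\<alpha> < 2" and "1/\<alpha> < H" and "H < 1"
    and "SaS_random_measure M \<alpha> Z"
    and "is_lfsm M H \<alpha> Z X"
    and "continuous_on UNIV \<psi>" and "\<exists>s. \<psi> s \<noteq> 0"
    and "\<And>s. s \<notin> {0..1} \<Longrightarrow> \<psi> s = 0"
    and "(\<integral>s. \<psi> s \<partial>lborel) = 0" and "(\<integral>s. s * \<psi> s \<partial>lborel) = 0"
  shows "AE \<omega> in M. \<forall>\<epsilon>>0.
    limsup (\<lambda>j. ereal (2 powr (real j * (H - 1/\<alpha> - \<epsilon>)) * wavelet_max X \<psi> j \<omega>)) < \<infinity>"
proof -
  interpret SaS_random_measure M \<alpha> Z by fact
  have "0 < 1 / \<alpha>" using assms by simp
  then have "0 < H" using assms by linarith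
  have "\<exists>C\<ge>0. \<forall>j. \<forall>l>0. \<exists>E\<in>events. {\<omega> \<in> space M. l \<le> wavelet_max X \<psi> j \<omega>} \<subseteq> E \<and>
      prob E \<le> C * 2 powr (real j * (1 - \<alpha> * H)) * l powr - \<alpha>"
    using \<open>1 < \<alpha>\<close> \<open>0 < H\<close> assms(6,7,9,10) by (rule wavelet_max_tail)
  then obtain C where "0 \<le> C" and C: "\<forall>j. \<forall>l>0. \<exists>E\<in>events. {\<omega> \<in> space M. l \<le> wavelet_max X \<psi> j \<omega>} \<subseteq> E \<and>
      prob E \<le> C * 2 powr (real j * (1 - \<alpha> * H)) * l powr - \<alpha>"
    by (elim exE conjE) (rule that)
  \<comment> \<open>The exceptional null set must serve all \<open>\<epsilon>\<close> at once, so
    only the values \<open>1 / real (Suc m)\<close> are treated, and their null sets are combined.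
    The level \<open>l m j\<close> is the reciprocal of the normalising factor for that
    value.\<close>
  define l where "l = (\<lambda>m j::nat. 2 powr - (real j * (H - 1/\<alpha> - 1 / real (Suc m))))"
  have "AE \<omega> in M. \<forall>\<^sub>F j in sequentially. \<not> l m j \<le> wavelet_max X \<psi> j \<omega>" for m
  proof -
    \<comment> \<open>In \<open>l m j powr - \<alpha>\<close> the exponent is
      \<open>real j * (\<alpha> * H - 1 - \<alpha> / real (Suc m))\<close>. It cancels the growth
      \<open>real j * (1 - \<alpha> * H)\<close> from the union bound and leaves a geometric series
      of ratio \<open>q < 1\<close>.\<close>
    define q where "q = 2 powr - (\<alpha> / real (Suc m))"
    have "\<forall>j. \<exists>E. E \<in> events \<and> {\<omega> \<in> space M. l m j \<le> wavelet_max X \<psi> j \<omega>} \<subseteq> E \<and>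
        prob E \<le> C * 2 powr (real j * (1 - \<alpha> * H)) * l m j powr - \<alpha>"
    proof
      fix j
      have "0 < l m j" by (simp add: l_def)
      from C[rule_format, OF this, of j] show "\<exists>E. E \<in> events \<and> {\<omega> \<in> space M. l m j \<le> wavelet_max X \<psi> j \<omega>} \<subseteq> E \<and>
        prob E \<le> C * 2 powr (real j * (1 - \<alpha> * H)) * l m j powr - \<alpha>"
        by (simp only: Bex_def)
    qed
    then obtain E where E: "\<And>j. E j \<in> events" "\<And>j. {\<omega> \<in> space M. l m j \<le> wavelet_max X \<psi> j \<omega>} \<subseteq> E j"
        and pE: "\<And>j. prob (E j) \<le> C * 2 powr (real j * (1 - \<alpha> * H)) * l m j powr - \<alpha>"
      by metis
    have "AE \<omega> in M. \<forall>\<^sub>F j in sequentially. \<omega> \<in> space M - E j"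
    proof (rule borel_cantelli_AE1)
      have "C * 2 powr (real j * (1 - \<alpha> * H)) * l m j powr - \<alpha> = C * q ^ j" for j
      proof -
        have "l m j powr - \<alpha> = 2 powr (real j * (\<alpha> * H - 1 - \<alpha> / real (Suc m)))"
          using assms by (simp add: l_def powr_powr algebra_simps)
        then have "2 powr (real j * (1 - \<alpha> * H)) * l m j powr - \<alpha>
            = 2 powr (real j * (1 - \<alpha> * H) + real j * (\<alpha> * H - 1 - \<alpha> / real (Suc m)))"
          by (simp only: powr_add)
        also have "real j * (1 - \<alpha> * H) + real j * (\<alpha> * H - 1 - \<alpha> / real (Suc m)) = - (\<alpha> / real (Suc m)) * real j"
          by (simp only: distrib_left[symmetric]) simp
        also have "2 powr \<dots> = q ^ j"
          by (simp only: q_def powr_powr[symmetric]) (simp add: powr_realpow)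
        finally show ?thesis by simp
      qed
      then have pE': "prob (E j) \<le> C * q ^ j" for j using pE[of j] by (simp only:)
      have "q < 2 powr 0" unfolding q_def using assms by (intro powr_less_mono) auto
      then have "summable (\<lambda>j. C * q ^ j)"
        by (intro summable_mult summable_geometric) (simp add: q_def)
      then show "summable (\<lambda>j. prob (E j))"
        by (rule summable_comparison_test'[where N=0]) (use pE' in simp)
    qed (use E in \<open>auto simp: less_top[symmetric]\<close>)
    then show ?thesis
    proof eventually_elim
      case (elim \<omega>)
      then show ?case by eventually_elim (use E(2) in auto)
    qed
  qed
  then have "AE \<omega> in M. \<forall>m. \<forall>\<^sub>F j in sequentially. \<not> l m j \<le> wavelet_max X \<psi> j \<omega>"
    by (simp add: AE_all_countable)
  then show ?thesis
  proof (eventually_elim, safe)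
    fix \<omega> and \<epsilon> :: real
    assume ev: "\<forall>m. \<forall>\<^sub>F j in sequentially. \<not> l m j \<le> wavelet_max X \<psi> j \<omega>" and "0 < \<epsilon>"
    obtain m where m: "1 / real (Suc m) < \<epsilon>" using nat_approx_posE[OF \<open>0 < \<epsilon>\<close>] by blast
    have "limsup (\<lambda>j. ereal (2 powr (real j * (H - 1/\<alpha> - \<epsilon>)) * wavelet_max X \<psi> j \<omega>)) \<le> ereal 1"
    proof (rule Limsup_bounded)
      show "\<forall>\<^sub>F j in sequentially. ereal (2 powr (real j * (H - 1/\<alpha> - \<epsilon>)) * wavelet_max X \<psi> j \<omega>) \<le> ereal 1"
        using ev[rule_format, of m]
      proof eventually_elim
        case (elim j)
        have "2 powr (real j * (H - 1/\<alpha> - \<epsilon>)) * wavelet_max X \<psi> j \<omega> \<le> 2 powr (real j * (H - 1/\<alpha> - \<epsilon>)) * l m j"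
          using elim by (intro mult_left_mono) auto
        \<comment> \<open>Replacing \<open>\<epsilon>\<close> by the smaller
          \<open>1 / real (Suc m)\<close> only increases the power of 2, and the new factor is
          exactly the inverse of \<open>l m j\<close>.\<close>
        also have "\<dots> \<le> 2 powr (real j * (H - 1/\<alpha> - 1 / real (Suc m))) * l m j"
          using m by (intro mult_right_mono powr_mono mult_left_mono) (auto simp: l_def)
        also have "\<dots> = 1" by (simp add: l_def powr_minus)
        finally show ?case by simp
      qed
    qed
    then show "limsup (\<lambda>j. ereal (2 powr (real j * (H - 1/\<alpha> - \<epsilon>)) * wavelet_max X \<psi> j \<omega>)) < \<infinity>"
      by (rule le_less_trans) simp
  qed
qed

end
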